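(* Let $q\in\mathbb{C}$ with $|q|<1$, and let $k,n$ be positive integers with $n$ even. Then $$[2]_q\sum_{l=0}^{n-1}(-1)^{l-1}q^l l^k=q^n\sum_{m=0}^{k-1}\binom{k}{m}E_{m,q}\,n^{k-m}+(q^n-1)E_{k,q}.$$
   Context: Write $[2]_q=1+q$. The $q$-Euler polynomials $E_{n,q}(x)$ are defined by the Taylor expansion at $t=0$ $$\frac{[2]_q}{qe^t+1}e^{xt}=\sum_{n=0}^{\infty}E_{n,q}(x)\frac{t^n}{n!},$$ and the $q$-Euler numbers are $E_{n,q}=E_{n,q}(0)$. *)

theory Defs
  imports "HOL-Complex_Analysis.Complex_Analysis"
begin

definition q_euler_gf :: "complex \<Rightarrow> complex \<Rightarrow> complex \<Rightarrow> complex" where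
  "q_euler_gf q x t = (1 + q) / (q * exp t + 1) * exp (x * t)"

definition q_euler_poly :: "nat \<Rightarrow> complex \<Rightarrow> complex \<Rightarrow> complex" where
  "q_euler_poly n q x = fact n * fps_nth (fps_expansion (q_euler_gf q x) 0) n"

definition q_euler_number :: "nat \<Rightarrow> complex \<Rightarrow> complex" where
  "q_euler_number n q = q_euler_poly n q 0"

text \<open>
  The generating function has no pole at \<open>t = 0\<close> as soon as \<open>q \<noteq> -1\<close>, so its Taylor
  series converges to it near \<open>0\<close>.
\<close>

lemma q_euler_gf_has_fps_expansion:
  assumes "q \<noteq> -1"
  shows "q_euler_gf q x has_fps_expansion Abs_fps (\<lambda>n. q_euler_poly n q x / fact n)"
proof -
  have "q * exp 0 + 1 \<noteq> 0"
    using assms by (simp add: add_eq_0_iff2)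
  hence "q_euler_gf q x analytic_on {0}"
    unfolding q_euler_gf_def by (intro analytic_intros) auto
  hence "q_euler_gf q x has_fps_expansion fps_expansion (q_euler_gf q x) 0"
    by (rule analytic_at_imp_has_fps_expansion_0)
  also have "fps_expansion (q_euler_gf q x) 0 = Abs_fps (\<lambda>n. q_euler_poly n q x / fact n)"
    by (simp add: fps_eq_iff q_euler_poly_def)
  finally show ?thesis .
qed

end

theory Submission
  imports Defs
begin

text \<open>
  Put \<open>X = -q e\<^sup>t\<close> and let \<open>F\<close> be the generating function of the \<open>q\<close>-Euler numbers, so that
  \<open>(1 - X) F = 1 + q\<close>. Multiplying the geometric sum \<open>(1 - X) (1 + X + \<dots> + X\<^bsup>n-1\<^esup>) = 1 - X\<^sup>n\<close>
  by \<open>F\<close> gives \<open>(1 + q) (1 + X + \<dots> + X\<^bsup>n-1\<^esup>) = (1 - X\<^sup>n) F\<close>, and the identity is read off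
  from the coefficient of \<open>t\<^sup>k / k!\<close>.
\<close>

definition q_euler_fps :: "complex \<Rightarrow> complex fps" where
  "q_euler_fps q = Abs_fps (\<lambda>n. q_euler_number n q / fact n)"

text \<open>Since \<open>q \<noteq> -1\<close>, the denominator is nonzero at 0, hence near 0 by
  continuity. There it cancels as functions, and uniqueness of expansions carries this over to
  formal series.\<close>

lemma q_euler_fps_functional_equation:
  assumes "q \<noteq> -1"
  shows "(1 + fps_const q * fps_exp 1) * q_euler_fps q = fps_const (1 + q)"
proof -
  let ?f = "\<lambda>t. (1 + q * exp (1 * t)) * q_euler_gf q 0 t"
  have lhs: "?f has_fps_expansion (1 + fps_const q * fps_exp 1) * q_euler_fps q"
    unfolding q_euler_fps_def q_euler_number_def
    by (intro has_fps_expansion_mult has_fps_expansion_add has_fps_expansion_1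
          has_fps_expansion_const has_fps_expansion_exp q_euler_gf_has_fps_expansion assms)
  have "((\<lambda>t. 1 + q * exp t) \<longlongrightarrow> 1 + q * exp 0) (nhds 0)"
    by (intro tendsto_intros filterlim_ident)
  moreover have "1 + q * exp 0 \<noteq> 0"
    using assms by (simp add: add_eq_0_iff)
  ultimately have "eventually (\<lambda>t. 1 + q * exp t \<noteq> 0) (nhds 0)"
    by (rule tendsto_imp_eventually_ne)
  hence "eventually (\<lambda>t. ?f t = 1 + q) (nhds 0)"
    by eventually_elim (simp add: q_euler_gf_def add.commute)
  moreover have "(\<lambda>_. 1 + q) has_fps_expansion fps_const (1 + q)"
    by (rule has_fps_expansion_const)
  ultimately have "?f has_fps_expansion fps_const (1 + q)"
    by (subst has_fps_expansion_cong[OF _ refl])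
  with lhs show ?thesis
    by (rule fps_expansion_unique_complex)
qed

lemma q_euler_alternating_power_sum:
  assumes "q \<noteq> -1"
  shows "(1 + q) * (\<Sum>l<n. (-q) ^ l * of_nat l ^ k) = q_euler_number k q -
           (-q) ^ n * (\<Sum>m\<le>k. of_nat (k choose m) * q_euler_number m q * of_nat n ^ (k - m))"
proof -
  define X where "X = fps_const (-q) * fps_exp 1"
  \<comment> \<open>Powers of \<open>X\<close> stay exponentials, so the \<open>k\<close>-th
    coefficient of \<open>X ^ l\<close> times \<open>fact k\<close> is
    \<open>(-q) ^ l * of_nat l ^ k\<close>.\<close>
  have X_power: "X ^ l = fps_const ((-q) ^ l) * fps_exp (of_nat l)" for l
    by (simp add: X_def power_mult_distrib fps_const_power fps_exp_power_mult
             del: fps_const_neg)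
  have X_F: "(1 - X) * q_euler_fps q = fps_const (1 + q)"
    using q_euler_fps_functional_equation[OF assms]
    by (simp add: X_def flip: fps_const_neg)
  have "fps_const (1 + q) * (\<Sum>l<n. X ^ l) = ((1 - X) * (\<Sum>l<n. X ^ l)) * q_euler_fps q"
    by (simp add: X_F[symmetric] mult_ac del: fps_const_add)
  also have "\<dots> = q_euler_fps q - fps_const ((-q) ^ n) * (q_euler_fps q * fps_exp (of_nat n))"
    by (simp only: one_diff_power_eq[symmetric]) (simp add: X_power algebra_simps)
  finally have "fact k * fps_nth (fps_const (1 + q) * (\<Sum>l<n. X ^ l)) k =
      fact k * fps_nth (q_euler_fps q -
        fps_const ((-q) ^ n) * (q_euler_fps q * fps_exp (of_nat n))) k"
    by simp
  moreover have "fact k * fps_nth (fps_const (1 + q) * (\<Sum>l<n. X ^ l)) k =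
      (1 + q) * (\<Sum>l<n. (-q) ^ l * of_nat l ^ k)"
    by (simp add: fps_sum_nth X_power sum_distrib_left mult_ac del: fps_const_add)
  \<comment> \<open>A Cauchy product of exponential generating functions is a binomial
    convolution.\<close>
  moreover have "fact k * fps_nth (q_euler_fps q * fps_exp (of_nat n)) k =
      (\<Sum>m\<le>k. of_nat (k choose m) * q_euler_number m q * of_nat n ^ (k - m))"
    unfolding fps_mult_nth
    by (simp add: q_euler_fps_def sum_distrib_left binomial_fact field_simps atLeast0AtMost)
  ultimately show ?thesis
    by (simp add: right_diff_distrib mult.left_commute[of "fact k"] q_euler_fps_def)
qed

theorem theorem6:
  fixes q :: complex and k n :: nat
  assumes "norm q < 1" and "k > 0" and "n > 0" and "even n"
  shows "(1 + q) * (\<Sum>l=0..n-1. (-1) powi (int l - 1) * q ^ l * of_nat l ^ k) =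
         q ^ n * (\<Sum>m=0..k-1. of_nat (k choose m) * q_euler_number m q * of_nat n ^ (k - m))
         + (q ^ n - 1) * q_euler_number k q"
proof -
  have "q \<noteq> -1"
    using assms(1) by auto
  \<comment> \<open>Truncated subtraction: for \<open>n = 0\<close> the left side would be
    \<open>{0}\<close>.\<close>
  have "{0..n-1} = {..<n}"
    using assms(3) by auto
  \<comment> \<open>The exponent is an integer, so \<open>l = 0\<close> gives
    \<open>(-1) powi (-1) = -1\<close> and fits the pattern.\<close>
  moreover have "(-1) powi (int l - 1) * q ^ l = - ((-q) ^ l)" for l
    by (simp add: power_int_diff power_minus[of q])
  ultimately have lhs: "(\<Sum>l=0..n-1. (-1) powi (int l - 1) * q ^ l * of_nat l ^ k) =
      - (\<Sum>l<n. (-q) ^ l * of_nat l ^ k)"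
    by (simp add: sum_negf)
  \<comment> \<open>The term \<open>m = k\<close> is \<open>q_euler_number k q\<close> itself; it
    supplies the \<open>q ^ n\<close> in the factor \<open>q ^ n - 1\<close>.\<close>
  have "{..k} = insert k {0..k-1}"
    using assms(2) by auto
  hence "(\<Sum>m\<le>k. of_nat (k choose m) * q_euler_number m q * of_nat n ^ (k - m)) =
      q_euler_number k q +
      (\<Sum>m=0..k-1. of_nat (k choose m) * q_euler_number m q * of_nat n ^ (k - m))"
    using assms(2) by simp
  \<comment> \<open>Evenness of \<open>n\<close> turns \<open>(-q) ^ n\<close> into
    \<open>q ^ n\<close>.\<close>
  with q_euler_alternating_power_sum[OF \<open>q \<noteq> -1\<close>, of k n] show ?thesis
    unfolding lhs using assms(4) by (simp add: algebra_simps)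
qed

end
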